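(* For every fixed constant $k$, \texttt{MDD(min)} restricted to $k$-regular input graphs can be solved exactly in time polynomial in the number of vertices $n$.
   Context: \texttt{MDD(min)}: given a finite simple undirected graph $G=(V,E)$ and a distinguished vertex $p\in V$, find a set $S\subseteq V\setminus\{p\}$ of minimum cardinality such that $p$ is the unique vertex of minimum degree in the induced subgraph $G[V\setminus S]$. A graph is $k$-regular if every vertex has degree exactly $k$. *)

theory Defs
  imports "Graph_Theory.Graph_Theory" "HOL-Computational_Algebra.Polynomial"
begin

section \<open>Random access machines\<close>

text \<open>
  The model of computation is the random access machine of Cook and Reckhow
  (\<^emph>\<open>Time bounded random access machines\<close>, 1973), with a read-only input tape and a
  write-only output tape, over natural-number registers with truncated subtraction. Every
  instruction costs one unit of time. Multiplication is deliberately absent: each arithmetic step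
  lengthens the largest number by at most one bit, so that polynomial time on this machine is
  polynomial time on Turing machines.
\<close>

datatype instr =
    Const nat nat      \<comment> \<open>\<open>Const i c\<close>: \<open>X\<^sub>i := c\<close>\<close>
  | Add nat nat nat    \<comment> \<open>\<open>Add i j k\<close>: \<open>X\<^sub>i := X\<^sub>j + X\<^sub>k\<close>\<close>
  | Sub nat nat nat    \<comment> \<open>\<open>Sub i j k\<close>: \<open>X\<^sub>i := X\<^sub>j - X\<^sub>k\<close>\<close>
  | Load nat nat       \<comment> \<open>\<open>Load i j\<close>: \<open>X\<^sub>i := X\<^bsub>X\<^sub>j\<^esub>\<close>\<close>
  | Store nat nat      \<comment> \<open>\<open>Store i j\<close>: \<open>X\<^bsub>X\<^sub>i\<^esub> := X\<^sub>j\<close>\<close>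
  | JumpPos nat nat    \<comment> \<open>\<open>JumpPos l j\<close>: continue at instruction \<open>l\<close> if \<open>X\<^sub>j > 0\<close>\<close>
  | Read nat           \<comment> \<open>\<open>Read i\<close>: move the next input number to \<open>X\<^sub>i\<close> (0 if none is left)\<close>
  | Print nat          \<comment> \<open>\<open>Print i\<close>: append \<open>X\<^sub>i\<close> to the output\<close>

record ram_state =
  pc :: nat
  mem :: "nat \<Rightarrow> nat"
  inp :: "nat list"
  out :: "nat list"

fun exec_instr :: "instr \<Rightarrow> ram_state \<Rightarrow> ram_state" where
  "exec_instr (Const i c) s = s\<lparr>pc := pc s + 1, mem := (mem s)(i := c)\<rparr>"
| "exec_instr (Add i j k) s = s\<lparr>pc := pc s + 1, mem := (mem s)(i := mem s j + mem s k)\<rparr>"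
| "exec_instr (Sub i j k) s = s\<lparr>pc := pc s + 1, mem := (mem s)(i := mem s j - mem s k)\<rparr>"
| "exec_instr (Load i j) s = s\<lparr>pc := pc s + 1, mem := (mem s)(i := mem s (mem s j))\<rparr>"
| "exec_instr (Store i j) s = s\<lparr>pc := pc s + 1, mem := (mem s)(mem s i := mem s j)\<rparr>"
| "exec_instr (JumpPos l j) s = s\<lparr>pc := (if mem s j > 0 then l else pc s + 1)\<rparr>"
| "exec_instr (Read i) s =
     (case inp s of
        [] \<Rightarrow> s\<lparr>pc := pc s + 1, mem := (mem s)(i := 0)\<rparr>
      | x # xs \<Rightarrow> s\<lparr>pc := pc s + 1, mem := (mem s)(i := x), inp := xs\<rparr>)"
| "exec_instr (Print i) s = s\<lparr>pc := pc s + 1, out := out s @ [mem s i]\<rparr>"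

text \<open>A machine halts by leaving its program.\<close>

definition halted :: "instr list \<Rightarrow> ram_state \<Rightarrow> bool" where
  "halted P s \<longleftrightarrow> length P \<le> pc s"

definition ram_step :: "instr list \<Rightarrow> ram_state \<Rightarrow> ram_state" where
  "ram_step P s = (if halted P s then s else exec_instr (P ! pc s) s)"

definition init_state :: "nat list \<Rightarrow> ram_state" where
  "init_state xs = \<lparr>pc = 0, mem = (\<lambda>_. 0), inp = xs, out = []\<rparr>"

definition computes_within :: "instr list \<Rightarrow> nat list \<Rightarrow> nat \<Rightarrow> nat list \<Rightarrow> bool" where
  "computes_within P xs T ys \<longleftrightarrow>
     (\<exists>t\<le>T. let s = (ram_step P ^^ t) (init_state xs) in halted P s \<and> out s = ys)"

text \<open>
  A search problem on the instance set \<open>I\<close>, with input encoding \<open>enc\<close> and correctness relation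
  \<open>sol\<close> between instances and output tapes, is solvable in time polynomial in the parameter
  \<open>sz\<close> of the instance.
\<close>

definition poly_time_solvable ::
  "'i set \<Rightarrow> ('i \<Rightarrow> nat list) \<Rightarrow> ('i \<Rightarrow> nat list \<Rightarrow> bool) \<Rightarrow> ('i \<Rightarrow> nat) \<Rightarrow> bool" where
  "poly_time_solvable I enc sol sz \<longleftrightarrow>
     (\<exists>(P :: instr list) (q :: nat poly). \<forall>x\<in>I. \<exists>ys.
        computes_within P (enc x) (poly q (sz x)) ys \<and> sol x ys)"


section \<open>The minimum degree deletion problem\<close>

text \<open>
  A finite simple undirected graph is a \<^locale>\<open>pair_graph\<close>: an edge \<open>{u, v}\<close> is the pair of
  opposite arcs \<open>(u, v)\<close>, \<open>(v, u)\<close>, so the degree of a vertex is its out-degree.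
\<close>

abbreviation degree_in :: "('a, 'b) pre_digraph \<Rightarrow> 'a \<Rightarrow> nat" where
  "degree_in H v \<equiv> out_degree H v"

definition k_regular :: "nat \<Rightarrow> 'a pair_pre_digraph \<Rightarrow> bool" where
  "k_regular k G \<longleftrightarrow> (\<forall>v\<in>pverts G. degree_in (with_proj G) v = k)"

definition min_degree_verts :: "('a, 'b) pre_digraph \<Rightarrow> 'a set" where
  "min_degree_verts H = {v. is_arg_min (degree_in H) (\<lambda>u. u \<in> verts H) v}"

definition mdd_feasible :: "'a pair_pre_digraph \<Rightarrow> 'a \<Rightarrow> 'a set \<Rightarrow> bool" where
  "mdd_feasible G p S \<longleftrightarrow>
     S \<subseteq> pverts G - {p} \<and>
     min_degree_verts (induce_subgraph (with_proj G) (pverts G - S)) = {p}"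

definition mdd_min_solution :: "'a pair_pre_digraph \<Rightarrow> 'a \<Rightarrow> 'a set \<Rightarrow> bool" where
  "mdd_min_solution G p S \<longleftrightarrow> is_arg_min card (mdd_feasible G p) S"

text \<open>
  As inputs of a machine, graphs on \<open>n\<close> vertices have the vertex set \<open>{0, \<dots>, n - 1}\<close> and are
  given by \<open>n\<close>, the distinguished vertex and the adjacency matrix, row by row. The machine has
  to print the elements of an optimal set, in any order and without repetition.
\<close>

definition mdd_regular_instances :: "nat \<Rightarrow> (nat pair_pre_digraph \<times> nat) set" where
  "mdd_regular_instances k =
     {(G, p). pair_graph G \<and> pverts G = {0..<card (pverts G)} \<and> p \<in> pverts G \<and> k_regular k G}"

definition mdd_num_verts :: "nat pair_pre_digraph \<times> nat \<Rightarrow> nat" where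
  "mdd_num_verts = (\<lambda>(G, p). card (pverts G))"

definition mdd_encode :: "nat pair_pre_digraph \<times> nat \<Rightarrow> nat list" where
  "mdd_encode = (\<lambda>(G, p). let n = card (pverts G) in
     n # p # concat (map (\<lambda>u. map (\<lambda>v. of_bool ((u, v) \<in> parcs G)) [0..<n]) [0..<n]))"

definition mdd_min_output :: "nat pair_pre_digraph \<times> nat \<Rightarrow> nat list \<Rightarrow> bool" where
  "mdd_min_output = (\<lambda>(G, p) ys. distinct ys \<and> mdd_min_solution G p (set ys))"

end

theory Submission
  imports Defs
begin

text \<open>
  Let \<open>k > 0\<close> and let \<open>I\<close> be the set of vertices other than \<open>p\<close> whose neighbours are all
  neighbours of \<open>p\<close>. Deleting \<open>N(p) \<union> I\<close> isolates \<open>p\<close> and no other remaining vertex. By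
  regularity the vertices of \<open>I\<close> have the same neighbourhood as \<open>p\<close>, so \<open>I\<close> lies in the
  neighbourhood of any neighbour of \<open>p\<close>, and at most \<open>2 k\<close> vertices are deleted. An optimal set
  is therefore found by testing all tuples of length \<open>0, 1, \<dots>, 2 k\<close> in this order. By
  regularity again, a set \<open>S\<close> avoiding \<open>p\<close> is feasible iff every other remaining vertex has
  strictly fewer neighbours in \<open>S\<close> than \<open>p\<close>. For \<open>k = 0\<close> all vertices but \<open>p\<close> must be deleted.
\<close>

section \<open>A program logic with running times\<close>

type_synonym code = "nat \<Rightarrow> instr list"

text \<open>
  Code is a function of its load address, since jump targets are absolute. \<open>wp c T Q s\<close>: loaded
  at the current program counter inside any program, \<open>c\<close> reaches its end in at most \<open>T\<close> steps,
  in a state satisfying \<open>Q\<close>.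
\<close>

definition wp :: "code \<Rightarrow> nat \<Rightarrow> (ram_state \<Rightarrow> bool) \<Rightarrow> ram_state \<Rightarrow> bool" where
  "wp c T Q s \<longleftrightarrow> (\<forall>a b. length a = pc s \<longrightarrow>
     (\<exists>t\<le>T. \<exists>s'. (ram_step (a @ c (pc s) @ b) ^^ t) s = s' \<and>
        pc s' = pc s + length (c (pc s)) \<and> Q s'))"

definition basic :: "instr list \<Rightarrow> code" where
  "basic is = (\<lambda>_. is)"

definition seq :: "code \<Rightarrow> code \<Rightarrow> code" (infixr ";;" 60) where
  "c ;; d = (\<lambda>l. c l @ d (l + length (c l)))"

definition unless :: "nat \<Rightarrow> code \<Rightarrow> code" where
  "unless r c = (\<lambda>l. JumpPos (l + 1 + length (c (l + 1))) r # c (l + 1))"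

text \<open>
  Register 1 holds the number \<open>n\<close> of vertices throughout, register 0 is scratch. The test comes
  after the body, so the loop runs \<open>n\<close> times only if \<open>n > 0\<close>.
\<close>

definition for_loop :: "nat \<Rightarrow> code \<Rightarrow> code" where
  "for_loop i c =
     (\<lambda>l. Const i 0 # c (l + 1) @ [Const 0 1, Add i i 0, Sub 0 1 i, JumpPos (l + 1) 0])"

text \<open>The program counter is left free, so that invariants built from \<open>same\<close> survive jumps.\<close>

definition same :: "nat set \<Rightarrow> ram_state \<Rightarrow> ram_state \<Rightarrow> bool" where
  "same W s s' \<longleftrightarrow> (\<forall>j. j \<notin> W \<longrightarrow> mem s' j = mem s j) \<and> inp s' = inp s \<and> out s' = out s"

lemma steps_add: "(ram_step P ^^ (t + t')) s = (ram_step P ^^ t') ((ram_step P ^^ t) s)"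
  by (simp add: add.commute[of t] funpow_add)

lemma ram_step_at:
  assumes "length a = pc s"
  shows "ram_step (a @ i # b) s = exec_instr i s"
  using assms by (simp add: ram_step_def halted_def nth_append)

lemma wp_basic_Nil: "Q s \<Longrightarrow> wp (basic []) 0 Q s"
  by (simp add: wp_def basic_def)

text \<open>The surrounding program is arbitrary, so the code of \<open>d\<close> counts as suffix
  while \<open>c\<close> runs, and the code of \<open>c\<close> joins the prefix while
  \<open>d\<close> runs.\<close>

lemma wp_seq:
  assumes "wp c T (wp d T' Q) s"
  shows "wp (c ;; d) (T + T') Q s"
  unfolding wp_def
proof (intro allI impI)
  fix a b :: "instr list" assume a: "length a = pc s"
  let ?c = "c (pc s)" let ?d = "d (pc s + length ?c)"
  obtain t s' where t: "t \<le> T" "(ram_step (a @ ?c @ (?d @ b)) ^^ t) s = s'"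
    "pc s' = pc s + length ?c" "wp d T' Q s'"
    using assms a unfolding wp_def[of c] by meson
  have "length (a @ ?c) = pc s'" using t a by simp
  then obtain t' s'' where t': "t' \<le> T'" "(ram_step ((a @ ?c) @ ?d @ b) ^^ t') s' = s''"
    "pc s'' = pc s' + length ?d" "Q s''"
    using t(3,4) unfolding wp_def[of d] by metis
  show "\<exists>t\<le>T + T'. \<exists>s'. (ram_step (a @ (c ;; d) (pc s) @ b) ^^ t) s = s' \<and>
      pc s' = pc s + length ((c ;; d) (pc s)) \<and> Q s'"
    using t t' by (intro exI[of _ "t + t'"]) (simp add: seq_def steps_add)
qed

text \<open>Without jumps every instruction advances the program counter by one, so straight-line
  code acts as a fold and takes one step per instruction.\<close>

lemma wp_basic:
  assumes "\<forall>i\<in>set is. \<forall>l r. i \<noteq> JumpPos l r" "Q (fold exec_instr is s)"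
  shows "wp (basic is) (length is) Q s"
  using assms
proof (induction "is" arbitrary: s)
  case Nil
  then show ?case by (simp add: wp_basic_Nil)
next
  case (Cons i "is")
  have pc: "pc (exec_instr i s) = Suc (pc s)"
    using Cons.prems(1) by (cases i) (auto split: list.splits)
  have IH: "wp (basic is) (length is) Q (exec_instr i s)" using Cons by simp
  show ?case unfolding wp_def
  proof (intro allI impI)
    fix a b :: "instr list" assume a: "length a = pc s"
    have "length (a @ [i]) = pc (exec_instr i s)" using a pc by simp
    then obtain t s' where "t \<le> length is" 
      "(ram_step ((a @ [i]) @ is @ b) ^^ t) (exec_instr i s) = s'"
      "pc s' = pc (exec_instr i s) + length is" "Q s'"
      using IH unfolding wp_def basic_def by meson
    then show "\<exists>t\<le>length (i # is). \<exists>s'. (ram_step (a @ basic (i # is) (pc s) @ b) ^^ t) s = s' \<and>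
        pc s' = pc s + length (basic (i # is) (pc s)) \<and> Q s'"
      using a pc by (intro exI[of _ "Suc t"]) (simp add: basic_def ram_step_at funpow_Suc_right del: funpow.simps(2))
  qed
qed

text \<open>The landing address depends on where the code is loaded, hence the second premise asks
  for \<open>Q\<close> at every \<open>l\<close>.\<close>

lemma wp_unless:
  assumes "mem s r = 0 \<Longrightarrow> wp c T Q (s\<lparr>pc := Suc (pc s)\<rparr>)"
    and "\<And>l. mem s r > 0 \<Longrightarrow> Q (s\<lparr>pc := l\<rparr>)"
  shows "wp (unless r c) (Suc T) Q s"
  unfolding wp_def
proof (intro allI impI)
  fix a b :: "instr list" assume a: "length a = pc s"
  let ?c = "c (Suc (pc s))"
  let ?i = "JumpPos (pc s + 1 + length ?c) r"
  have step: "ram_step (a @ ?i # ?c @ b) s = exec_instr ?i s"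
    using a by (rule ram_step_at)
  show "\<exists>t\<le>Suc T. \<exists>s'. (ram_step (a @ unless r c (pc s) @ b) ^^ t) s = s' \<and>
      pc s' = pc s + length (unless r c (pc s)) \<and> Q s'"
  proof (cases "mem s r = 0")
    case True
    let ?s = "s\<lparr>pc := Suc (pc s)\<rparr>"
    have "length (a @ [?i]) = pc ?s" using a by simp
    then obtain t where "t \<le> T" "pc ((ram_step (a @ ?i # ?c @ b) ^^ t) ?s) = Suc (pc s) + length ?c"
        "Q ((ram_step (a @ ?i # ?c @ b) ^^ t) ?s)"
      using assms(1)[OF True, unfolded wp_def, rule_format, of "a @ [?i]" b] by auto
    then show ?thesis using True step
      by (intro exI[of _ "Suc t"]) (simp add: unless_def funpow_Suc_right del: funpow.simps(2))
  next
    case False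
    then show ?thesis using step assms(2)
      by (intro exI[of _ "Suc 0"]) (simp add: unless_def)
  qed
qed

text \<open>\<open>I v\<close> describes the state after \<open>v\<close> rounds. The loop's own
  instructions change only register 0, the counter and the program counter, which is what
  \<open>stable\<close> absorbs; they cost one step at the start and four per round.\<close>

lemma wp_for_loop:
  assumes n: "mem s 1 = n" "0 < n" and i: "i \<noteq> 0" "i \<noteq> 1"
    and init: "I 0 s"
    and stable: "\<And>v s s'. I v s \<Longrightarrow> same {0, i} s s' \<Longrightarrow> I v s'"
    and body: "\<And>v s. v < n \<Longrightarrow> I v s \<Longrightarrow> mem s i = v \<Longrightarrow> mem s 1 = n \<Longrightarrow>
      wp c T (\<lambda>s'. I (Suc v) s' \<and> mem s' i = v \<and> mem s' 1 = n) s"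
    and post: "\<And>s'. I n s' \<Longrightarrow> Q s'"
  shows "wp (for_loop i c) (1 + n * (T + 4)) Q s"
  unfolding wp_def
proof (intro allI impI)
  fix a b :: "instr list" assume a: "length a = pc s"
  define l where "l = pc s"
  let ?c = "c (Suc l)"
  define P where "P = a @ for_loop i c l @ b"
  have P: "P = a @ Const i 0 # ?c @ [Const 0 1, Add i i 0, Sub 0 1 i, JumpPos (Suc l) 0] @ b"
    by (simp add: P_def for_loop_def)
  \<comment> \<open>By truncated subtraction, register 0 ends up positive exactly when another round
    is due.\<close>
  have tail: "(ram_step P ^^ 4) s =
      s\<lparr>pc := if v < n - 1 then Suc l else l + length ?c + 5,
        mem := (mem s)(i := Suc v, 0 := n - Suc v)\<rparr>"
    if "pc s = Suc l + length ?c" "mem s i = v" "mem s 1 = n" for s v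
  proof -
    have P': "P = (a @ Const i 0 # ?c) @ Const 0 1 # Add i i 0 # Sub 0 1 i # JumpPos (Suc l) 0 # b"
      "P = (a @ Const i 0 # ?c @ [Const 0 1]) @ Add i i 0 # Sub 0 1 i # JumpPos (Suc l) 0 # b"
      "P = (a @ Const i 0 # ?c @ [Const 0 1, Add i i 0]) @ Sub 0 1 i # JumpPos (Suc l) 0 # b"
      "P = (a @ Const i 0 # ?c @ [Const 0 1, Add i i 0, Sub 0 1 i]) @ JumpPos (Suc l) 0 # b"
      by (simp_all add: P)
    define s1 where "s1 = exec_instr (Const 0 1) s"
    define s2 where "s2 = exec_instr (Add i i 0) s1"
    define s3 where "s3 = exec_instr (Sub 0 1 i) s2"
    have 1: "ram_step P s = s1" unfolding P'(1) s1_def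
      by (rule ram_step_at) (use a that in \<open>simp add: l_def\<close>)
    have 2: "ram_step P s1 = s2" unfolding P'(2) s2_def
      by (rule ram_step_at) (use a that in \<open>simp add: l_def s1_def\<close>)
    have 3: "ram_step P s2 = s3" unfolding P'(3) s3_def
      by (rule ram_step_at) (use a that in \<open>simp add: l_def s1_def s2_def\<close>)
    have 4: "ram_step P s3 = exec_instr (JumpPos (Suc l) 0) s3" unfolding P'(4)
      by (rule ram_step_at) (use a that in \<open>simp add: l_def s1_def s2_def s3_def\<close>)
    have "(ram_step P ^^ 4) s = exec_instr (JumpPos (Suc l) 0) s3"
      using 1 2 3 4 by (simp add: eval_nat_numeral)
    also have "\<dots> = s\<lparr>pc := if v < n - 1 then Suc l else l + length ?c + 5,
        mem := (mem s)(i := Suc v, 0 := n - Suc v)\<rparr>"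
      using that i by (auto simp: s1_def s2_def s3_def fun_eq_iff)
    finally show ?thesis .
  qed
  \<comment> \<open>Induction on the number \<open>n - v\<close> of remaining rounds, each starting
    at the first instruction of the body.\<close>
  have loop: "\<exists>t\<le>(n - v) * (T + 4). \<exists>s'. (ram_step P ^^ t) s = s' \<and>
      pc s' = l + length ?c + 5 \<and> I n s'"
    if "v < n" "I v s" "pc s = Suc l" "mem s i = v" "mem s 1 = n" for v s
    using that
  proof (induction "n - v" arbitrary: v s rule: less_induct)
    case less
    have "length (a @ [Const i 0]) = pc s" using a less.prems by (simp add: l_def)
    moreover have "P = (a @ [Const i 0]) @ c (pc s) @
        ([Const 0 1, Add i i 0, Sub 0 1 i, JumpPos (Suc l) 0] @ b)"
      using less.prems by (simp add: P)
    ultimately obtain t s1 where t: "t \<le> T" "(ram_step P ^^ t) s = s1"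
      "pc s1 = pc s + length ?c" "I (Suc v) s1" "mem s1 i = v" "mem s1 1 = n"
      using body[OF less.prems(1,2,4,5)] less.prems(3) unfolding wp_def by metis
    define s2 where "s2 = s1\<lparr>pc := if v < n - 1 then Suc l else l + length ?c + 5,
        mem := (mem s1)(i := Suc v, 0 := n - Suc v)\<rparr>"
    have s2: "(ram_step P ^^ (t + 4)) s = s2"
      unfolding steps_add t(2) s2_def
      by (rule tail) (use t less.prems in auto)
    have I: "I (Suc v) s2"
      by (rule stable[OF t(4)]) (simp add: same_def s2_def)
    show ?case
    proof (cases "Suc v < n")
      case True
      have "\<exists>t\<le>(n - Suc v) * (T + 4). \<exists>s'. (ram_step P ^^ t) s2 = s' \<and>
          pc s' = l + length ?c + 5 \<and> I n s'"
        using True I t i by (intro less.hyps) (auto simp: s2_def)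
      then obtain t' s' where t': "t' \<le> (n - Suc v) * (T + 4)" "(ram_step P ^^ t') s2 = s'"
          "pc s' = l + length ?c + 5" "I n s'" by blast
      have "(ram_step P ^^ ((t + 4) + t')) s = s'" 
        using s2 t' unfolding steps_add[where t = "t + 4"] by simp
      moreover have "(t + 4) + t' \<le> (n - v) * (T + 4)"
      proof -
        have "n - v = Suc (n - Suc v)" using True by simp
        then show ?thesis using t(1) t'(1) by simp
      qed
      ultimately show ?thesis using t' by blast
    next
      case False
      then have "n = Suc v" using less.prems by simp
      then show ?thesis using s2 I t(1) by (intro exI[of _ "t + 4"]) (auto simp: s2_def)
    qed
  qed
  define s0 where "s0 = s\<lparr>pc := Suc l, mem := (mem s)(i := 0)\<rparr>"
  have s0: "ram_step P s = s0"
    using ram_step_at[OF a, of "Const i 0"] by (simp add: P s0_def l_def)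
  have "I 0 s0" by (rule stable[OF init]) (simp add: same_def s0_def)
  then obtain t s' where t: "t \<le> n * (T + 4)" "(ram_step P ^^ t) s0 = s'"
      "pc s' = l + length ?c + 5" "I n s'"
    using loop[of 0 s0] n i by (auto simp: s0_def)
  show "\<exists>t\<le>1 + n * (T + 4). \<exists>s'. (ram_step (a @ for_loop i c (pc s) @ b) ^^ t) s = s' \<and>
      pc s' = pc s + length (for_loop i c (pc s)) \<and> Q s'"
    unfolding l_def[symmetric] P_def[symmetric]
    using t s0 post
    by (intro exI[of _ "Suc t"]) (simp add: funpow_Suc_right for_loop_def del: funpow.simps(2))
qed

text \<open>With empty surroundings the end of the code is the end of the program, where the machine
  halts.\<close>

lemma wp_computes:
  assumes "wp c T Q (init_state xs)"
  shows "\<exists>s. computes_within (c 0) xs T (out s) \<and> Q s"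
proof -
  obtain t s where "t \<le> T" "(ram_step (c 0) ^^ t) (init_state xs) = s" "pc s = length (c 0)" "Q s"
    using assms unfolding wp_def
    by (auto simp: init_state_def dest: spec[of _ "[]"])
  then show ?thesis unfolding computes_within_def halted_def by (intro exI[of _ s]) (auto simp: Let_def)
qed

lemma wp_basic_seq:
  assumes "\<forall>i\<in>set is. \<forall>l r. i \<noteq> JumpPos l r" "wp c T Q (fold exec_instr is s)"
  shows "wp (basic is ;; c) (length is + T) Q s"
  by (intro wp_seq wp_basic assms)


section \<open>Testing a tuple\<close>

text \<open>
  Register use: 1 and 2 hold \<open>n\<close> and \<open>p\<close>, 3 the address of row \<open>p\<close> of the adjacency matrix,
  4 and 5 the current row address and vertex \<open>v\<close>, 6 and 7 the numbers of neighbours of \<open>p\<close> and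
  \<open>v\<close> in the tuple, 8 the multiplicity of \<open>v\<close>, 9 the violations, 10 whether a solution has been
  printed, 13 and 14 the constants 1 and 0; 11 and 12 are scratch. The tuple occupies the
  registers from 20 on, and the matrix those from \<open>20 + K\<close> on, where \<open>K\<close> is the maximal
  length of a tuple.
\<close>

definition tuple :: "nat \<Rightarrow> ram_state \<Rightarrow> nat list" where
  "tuple m s = map (\<lambda>j. mem s (20 + j)) [0..<m]"

text \<open>The tuple length is known when the program is built, so the iteration over the entries
  is unrolled.\<close>

definition add_entries :: "nat \<Rightarrow> nat \<Rightarrow> nat \<Rightarrow> instr list" where
  "add_entries d r m = concat (map (\<lambda>j. [Add 11 r (20 + j), Load 11 11, Add d d 11]) [0..<m])"

text \<open>Two truncated subtractions add up to the distance of the two numbers; 1 minus that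
  distance is the indicator of equality.\<close>

definition count_equal :: "nat \<Rightarrow> instr list" where
  "count_equal j = [Sub 11 5 j, Sub 12 j 5, Add 11 11 12, Sub 11 13 11, Add 8 8 11]"

definition count_tuple :: "nat \<Rightarrow> instr list" where
  "count_tuple m = concat (map (\<lambda>j. count_equal (20 + j)) [0..<m])"

lemma tuple_cong: "(\<And>j. j < m \<Longrightarrow> mem s' (20 + j) = mem s (20 + j)) \<Longrightarrow> tuple m s' = tuple m s"
  by (simp add: tuple_def)

lemma same_refl: "same W s s"
  by (simp add: same_def)

lemma same_trans: "same W s s' \<Longrightarrow> same W' s' s'' \<Longrightarrow> W \<subseteq> V \<Longrightarrow> W' \<subseteq> V \<Longrightarrow> same V s s''"
  unfolding same_def by (metis subsetD)

lemma same_mem: "same W s s' \<Longrightarrow> j \<notin> W \<Longrightarrow> mem s' j = mem s j"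
  by (simp add: same_def)

lemma same_tuple: "same W s s' \<Longrightarrow> W \<subseteq> {..<20} \<Longrightarrow> tuple m s' = tuple m s"
  by (rule tuple_cong) (auto simp: same_def)

text \<open>Only registers 11 and \<open>d\<close> change, and both lie below 20. As the base
  address is at least 20, the summands read on the way still have their original values.\<close>

lemma add_entries:
  assumes "d < 20" "r < 20" "d \<noteq> 11" "r \<noteq> 11" "r \<noteq> d" "20 \<le> mem s r"
  shows "same {11, d} s (fold exec_instr (add_entries d r m) s) \<and>
    mem (fold exec_instr (add_entries d r m) s) d
      = mem s d + (\<Sum>x\<leftarrow>tuple m s. mem s (mem s r + x))"
proof (induction m)
  case 0
  then show ?case by (simp add: add_entries_def tuple_def same_refl)
next
  case (Suc m)
  define s' where "s' = fold exec_instr (add_entries d r m) s"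
  have IH: "same {11, d} s s'" "mem s' d = mem s d + (\<Sum>x\<leftarrow>tuple m s. mem s (mem s r + x))"
    using Suc by (auto simp: s'_def)
  have eq: "fold exec_instr (add_entries d r (Suc m)) s =
     fold exec_instr [Add 11 r (20 + m), Load 11 11, Add d d 11] s'"
    by (simp add: add_entries_def s'_def)
  have 1: "mem s' r = mem s r" "mem s' (20 + m) = mem s (20 + m)"
    using assms by (auto intro!: same_mem[OF IH(1)])
  have 2: "mem s' (mem s r + mem s (20 + m)) = mem s (mem s r + mem s (20 + m))"
    by (rule same_mem[OF IH(1)]) (use assms in auto)
  show ?case unfolding eq
    using 1 2 IH assms by (auto simp: same_def tuple_def)
qed

lemma count_equal:
  assumes "j \<notin> {5, 8, 11, 12, 13}" "mem s 13 = 1"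
  shows "same {8, 11, 12} s (fold exec_instr (count_equal j) s) \<and>
    mem (fold exec_instr (count_equal j) s) 8 = mem s 8 + of_bool (mem s j = mem s 5)"
  using assms by (auto simp: count_equal_def same_def)

lemma count_tuple:
  assumes "mem s 13 = 1"
  shows "same {8, 11, 12} s (fold exec_instr (count_tuple m) s) \<and>
    mem (fold exec_instr (count_tuple m) s) 8 = mem s 8 + count_list (tuple m s) (mem s 5)"
proof (induction m)
  case 0
  then show ?case by (simp add: count_tuple_def tuple_def same_refl)
next
  case (Suc m)
  define s' where "s' = fold exec_instr (count_tuple m) s"
  have IH: "same {8, 11, 12} s s'" "mem s' 8 = mem s 8 + count_list (tuple m s) (mem s 5)"
    using Suc by (auto simp: s'_def)
  have eq: "fold exec_instr (count_tuple (Suc m)) s = fold exec_instr (count_equal (20 + m)) s'"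
    by (simp add: count_tuple_def s'_def)
  have 1: "mem s' 5 = mem s 5" "mem s' (20 + m) = mem s (20 + m)" "mem s' 13 = 1"
    using assms same_mem[OF IH(1)] by auto
  have "same {8, 11, 12} s' (fold exec_instr (count_equal (20 + m)) s') \<and>
    mem (fold exec_instr (count_equal (20 + m)) s') 8 = mem s' 8 + of_bool (mem s' (20 + m) = mem s' 5)"
    by (rule count_equal) (use 1 in auto)
  then show ?case unfolding eq
    using 1 IH by (auto simp: tuple_def intro: same_trans)
qed

text \<open>The data that loading sets up and the search leaves alone; \<open>L\<close> is the
  adjacency matrix read row by row.\<close>

definition env :: "nat \<Rightarrow> nat \<Rightarrow> nat \<Rightarrow> nat list \<Rightarrow> ram_state \<Rightarrow> bool" where
  "env K n p L s \<longleftrightarrow> mem s 1 = n \<and> mem s 2 = p \<and> mem s 3 = 20 + K + p * n \<and> mem s 13 = 1 \<and>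
     mem s 14 = 0 \<and> (\<forall>i<n * n. mem s (20 + K + i) = L ! i)"

text \<open>For an adjacency matrix \<open>L\<close>, this is the number of neighbours of
  \<open>u\<close> in the tuple, with multiplicity.\<close>

definition row_sum :: "nat \<Rightarrow> nat list \<Rightarrow> nat list \<Rightarrow> nat \<Rightarrow> nat" where
  "row_sum n L xs u = (\<Sum>x\<leftarrow>xs. L ! (u * n + x))"

definition multiplicity_with :: "nat \<Rightarrow> nat list \<Rightarrow> nat \<Rightarrow> nat" where
  "multiplicity_with p xs v = of_bool (p = v) + count_list xs v"

text \<open>
  With \<open>p\<close> counted in, multiplicities at most 1 say that the tuple is injective and avoids
  \<open>p\<close>. By truncated subtraction the first summand is nonzero iff \<open>v\<close> is neither \<open>p\<close> nor in the
  tuple, and has at least as many neighbours in the tuple as \<open>p\<close>.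
\<close>

definition violation :: "nat \<Rightarrow> nat \<Rightarrow> nat list \<Rightarrow> nat list \<Rightarrow> nat \<Rightarrow> nat" where
  "violation n p L xs v =
     (1 - (row_sum n L xs p - row_sum n L xs v + multiplicity_with p xs v)) + (multiplicity_with p xs v - 1)"

definition good :: "nat \<Rightarrow> nat \<Rightarrow> nat list \<Rightarrow> nat list \<Rightarrow> bool" where
  "good n p L xs \<longleftrightarrow> set xs \<subseteq> {..<n} \<and> (\<forall>v<n. violation n p L xs v = 0)"

text \<open>The final addition of register 1, which holds \<open>n\<close>, moves the row address on
  to the next vertex.\<close>

definition check_vertex :: "nat \<Rightarrow> instr list" where
  "check_vertex m = Const 7 0 # add_entries 7 4 m @ Const 8 0 # count_equal 2 @ count_tuple m @
     [Sub 11 6 7, Add 11 11 8, Sub 11 13 11, Add 9 9 11, Sub 11 8 13, Add 9 9 11, Add 4 4 1]"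

text \<open>The count of violations starts from register 10 instead of 0: once a solution is
  printed, it can never be 0 again, so nothing more is printed.\<close>

definition check_tuple :: "nat \<Rightarrow> nat \<Rightarrow> code" where
  "check_tuple K m =
     basic ([Const 6 0] @ add_entries 6 3 m @ [Add 9 10 14, Const 4 (20 + K)]) ;;
     for_loop 5 (basic (check_vertex m)) ;;
     unless 9 (basic (map (\<lambda>j. Print (20 + j)) [0..<m] @ [Const 10 1]))"

lemma row_address:
  assumes "u < n" "x < n"
  shows "u * n + x < n * (n::nat)"
proof -
  have "u * n + x < Suc u * n" using assms by simp
  also have "\<dots> \<le> n * n" using assms by (intro mult_right_mono) auto
  finally show ?thesis .
qed

lemma env_same:
  assumes "env K n p L s" "same W s s'" "W \<subseteq> {..<20 + K} - {1, 2, 3, 13, 14}"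
  shows "env K n p L s'"
proof -
  have "mem s' j = mem s j" if "j \<in> {1, 2, 3, 13, 14} \<or> j \<ge> 20 + K" for j
    using assms(2,3) that by (auto simp: same_def)
  then show ?thesis using assms(1) by (simp add: env_def)
qed

lemma env_row_sum:
  assumes "env K n p L s" "u < n" "set xs \<subseteq> {..<n}"
  shows "(\<Sum>x\<leftarrow>xs. mem s (20 + K + u * n + x)) = row_sum n L xs u"
  unfolding row_sum_def
proof (rule arg_cong[where f = sum_list], rule map_cong)
  fix x assume "x \<in> set xs"
  then have "u * n + x < n * n" using assms by (intro row_address) auto
  then show "mem s (20 + K + u * n + x) = L ! (u * n + x)"
    using assms by (simp add: env_def add.assoc)
qed simp

lemma check_vertex:
  assumes env: "env K n p L s" and xs: "tuple m s = xs" "set xs \<subseteq> {..<n}"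
    and v: "mem s 5 = v" "v < n" "mem s 4 = 20 + K + v * n" "mem s 6 = row_sum n L xs p"
  defines "s' \<equiv> fold exec_instr (check_vertex m) s"
  shows "same {4, 7, 8, 9, 11, 12} s s'" "mem s' 4 = 20 + K + Suc v * n"
    "mem s' 9 = mem s 9 + violation n p L xs v"
proof -
  define s1 where "s1 = exec_instr (Const 7 0) s"
  define s2 where "s2 = fold exec_instr (add_entries 7 4 m) s1"
  define s3 where "s3 = exec_instr (Const 8 0) s2"
  define s4 where "s4 = fold exec_instr (count_equal 2) s3"
  define s5 where "s5 = fold exec_instr (count_tuple m) s4"
  have s': "s' = fold exec_instr [Sub 11 6 7, Add 11 11 8, Sub 11 13 11, Add 9 9 11, Sub 11 8 13,
      Add 9 9 11, Add 4 4 1] s5"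
    by (simp add: s'_def check_vertex_def s5_def s4_def s3_def s2_def s1_def)
  have 1: "same {7} s s1" "mem s1 7 = 0" by (simp_all add: s1_def same_def)
  have env1: "env K n p L s1" by (rule env_same[OF env 1(1)]) auto
  have "tuple m s1 = xs" using same_tuple[OF 1(1)] xs by simp
  moreover have "mem s1 4 = 20 + K + v * n" using same_mem[OF 1(1)] v by simp
  ultimately have 2: "same {11, 7} s1 s2" "mem s2 7 = row_sum n L xs v"
    using add_entries[of 7 4 s1 m] 1(2) env_row_sum[OF env1 v(2) xs(2)]
    by (simp_all add: s2_def)
  have 12: "same {7, 11} s s2" by (rule same_trans[OF 1(1) 2(1)]) auto
  have 3: "same {8} s2 s3" "mem s3 8 = 0" by (simp_all add: s3_def same_def)
  have 13: "same {7, 8, 11} s s3" by (rule same_trans[OF 12 3(1)]) auto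
  have m3: "mem s3 13 = 1" "mem s3 2 = p" "mem s3 5 = v"
    using same_mem[OF 13] env v by (simp_all add: env_def)
  have 4: "same {8, 11, 12} s3 s4" "mem s4 8 = of_bool (p = v)"
    using count_equal[of 2 s3] m3 3(2) by (simp_all add: s4_def)
  have 14: "same {7, 8, 11, 12} s s4" by (rule same_trans[OF 13 4(1)]) auto
  have m4: "mem s4 13 = 1" "mem s4 5 = v" using same_mem[OF 14] env v by (simp_all add: env_def)
  have "tuple m s4 = xs" using same_tuple[OF 14] xs by simp
  then have 5: "same {8, 11, 12} s4 s5" "mem s5 8 = multiplicity_with p xs v"
    using count_tuple[of s4 m] m4 4(2) by (simp_all add: s5_def multiplicity_with_def)
  have 15: "same {7, 8, 11, 12} s s5" by (rule same_trans[OF 14 5(1)]) auto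
  have "mem s5 7 = mem s2 7"
    using same_mem[OF 3(1), of 7] same_mem[OF 4(1), of 7] same_mem[OF 5(1), of 7] by simp
  then have m5: "mem s5 7 = row_sum n L xs v" "mem s5 6 = row_sum n L xs p" "mem s5 13 = 1"
    "mem s5 1 = n" "mem s5 4 = 20 + K + v * n" "mem s5 9 = mem s 9"
    using same_mem[OF 15] env v 2 by (simp_all add: env_def)
  have "same {4, 9, 11} s5 s'" by (simp add: s' same_def)
  then show "same {4, 7, 8, 9, 11, 12} s s'" by (rule same_trans[OF 15]) auto
  show "mem s' 4 = 20 + K + Suc v * n" using m5 by (simp add: s')
  show "mem s' 9 = mem s 9 + violation n p L xs v"
    using m5 5(2) by (simp add: s' violation_def)
qed

lemma no_jump_check:
  "\<forall>i\<in>set (add_entries d r m). \<forall>l r. i \<noteq> JumpPos l r"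
  "\<forall>i\<in>set (check_vertex m). \<forall>l r. i \<noteq> JumpPos l r"
  by (auto simp: check_vertex_def add_entries_def count_tuple_def count_equal_def)

lemma length_check_vertex: "length (check_vertex m) = 8 * m + 14"
  by (simp add: check_vertex_def add_entries_def count_tuple_def count_equal_def length_concat
    comp_def sum_list_triv)

lemma fold_Print:
  "fold exec_instr (map (\<lambda>j. Print (20 + j)) [0..<m]) s =
     s\<lparr>pc := pc s + m, out := out s @ tuple m s\<rparr>"
  by (induction m) (simp_all add: tuple_def)

definition check_time :: "nat \<Rightarrow> nat \<Rightarrow> nat" where
  "check_time m n = (3 * m + 3) + ((1 + n * ((8 * m + 14) + 4)) + Suc (m + 1))"

text \<open>Besides the verdict, the registers from 20 on must be known to survive, since the tuple
  stored there also serves as the counters of the enclosing loops.\<close>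

lemma wp_check_tuple:
  assumes env: "env K n p L s" "0 < n" "p < n" and xs: "tuple m s = xs" "set xs \<subseteq> {..<n}"
    and Q: "\<And>s'. env K n p L s' \<Longrightarrow> (\<And>j. 20 \<le> j \<Longrightarrow> mem s' j = mem s j) \<Longrightarrow>
      (if mem s 10 = 0 \<and> good n p L xs then mem s' 10 = 1 \<and> out s' = out s @ xs
       else mem s' 10 = mem s 10 \<and> out s' = out s) \<Longrightarrow> Q s'"
  shows "wp (check_tuple K m) (check_time m n) Q s"
proof -
  let ?W = "{4, 5, 6, 7, 8, 9, 11, 12, 0 :: nat}"
  let ?is = "[Const 6 0] @ add_entries 6 3 m @ [Add 9 10 14, Const 4 (20 + K)]"
  define s1 where "s1 = exec_instr (Const 6 0) s"
  define s2 where "s2 = fold exec_instr (add_entries 6 3 m) s1"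
  define s3 where "s3 = fold exec_instr ?is s"
  have s3: "s3 = fold exec_instr [Add 9 10 14, Const 4 (20 + K)] s2"
    by (simp add: s3_def s2_def s1_def)
  have 1: "same {6} s s1" "mem s1 6 = 0" by (simp_all add: s1_def same_def)
  have env1: "env K n p L s1" by (rule env_same[OF env(1) 1(1)]) auto
  have "tuple m s1 = xs" using same_tuple[OF 1(1)] xs by simp
  then have 2: "same {11, 6} s1 s2" "mem s2 6 = row_sum n L xs p"
    using add_entries[of 6 3 s1 m] 1(2) env_row_sum[OF env1 env(3) xs(2)] env1
    by (simp_all add: s2_def env_def)
  have 12: "same {6, 11} s s2" by (rule same_trans[OF 1(1) 2(1)]) auto
  have "same {4, 9} s2 s3" by (simp add: s3 same_def)
  then have 13: "same ?W s s3" by (rule same_trans[OF 12]) auto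
  have m3: "mem s3 6 = row_sum n L xs p" "mem s3 4 = 20 + K" "mem s3 9 = mem s 10"
    using 2(2) same_mem[OF 12] env(1) by (simp_all add: s3 env_def)
  have W: "?W \<subseteq> {..<20 + K} - {1, 2, 3, 13, 14}" "?W \<subseteq> {..<20}" by auto
  have env3: "env K n p L s3" using env_same[OF env(1) 13 W(1)] .
  \<comment> \<open>Register 9 accumulates the violations of the vertices below \<open>v\<close> on
    top of the flag from register 10; register 4 points to row \<open>v\<close>.\<close>
  define I where "I v t \<longleftrightarrow> same ?W s t \<and> mem t 6 = row_sum n L xs p \<and> mem t 4 = 20 + K + v * n \<and>
    mem t 9 = mem s 10 + (\<Sum>u<v. violation n p L xs u)" for v t
  have I_env: "env K n p L t" "tuple m t = xs" if "I v t" for v t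
    using that env_same[OF env(1) _ W(1)] same_tuple[OF _ W(2)] xs by (auto simp: I_def)
  have last: "wp (unless 9 (basic (map (\<lambda>j. Print (20 + j)) [0..<m] @ [Const 10 1])))
      (Suc (m + 1)) Q t" if I: "I n t" for t
  proof (rule wp_unless)
    have t: "same ?W s t" using I by (simp add: I_def)
    have 10: "mem t 10 = mem s 10" using same_mem[OF t] by simp
    have 9: "mem t 9 = 0 \<longleftrightarrow> mem s 10 = 0 \<and> good n p L xs"
      using I xs by (auto simp: I_def good_def)
    {
      assume z: "mem t 9 = 0"
      let ?t = "t\<lparr>pc := Suc (pc t)\<rparr>"
      let ?js = "map (\<lambda>j. Print (20 + j)) [0..<m] @ [Const 10 1]"
      \<comment> \<open>\<open>same\<close> fixes the output, so the printing is undone here in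
        order to transfer \<open>env\<close>, which ignores the output.\<close>
      have t': "same {10} t (fold exec_instr ?js ?t \<lparr>out := out t\<rparr>)"
        "mem (fold exec_instr ?js ?t) 10 = 1" "out (fold exec_instr ?js ?t) = out t @ tuple m t"
        by (simp_all add: fold_Print same_def tuple_def)
      have "env K n p L (fold exec_instr ?js ?t \<lparr>out := out t\<rparr>)"
        by (rule env_same[OF I_env(1)[OF I] t'(1)]) auto
      then have "env K n p L (fold exec_instr ?js ?t)" by (simp add: env_def)
      moreover have "mem (fold exec_instr ?js ?t) j = mem s j" if "20 \<le> j" for j
        using same_mem[OF t, of j] same_mem[OF t'(1), of j] that by auto
      ultimately have "Q (fold exec_instr ?js ?t)"
        using t' z 9 t I_env(2)[OF I] by (intro Q) (auto simp: same_def)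
      then have "wp (basic ?js) (length ?js) Q ?t" by (intro wp_basic) auto
      then show "wp (basic ?js) (m + 1) Q ?t" by simp
    next
      fix l assume z: "mem t 9 > 0"
      have "env K n p L (t\<lparr>pc := l\<rparr>)" using I_env(1)[OF I] by (simp add: env_def)
      moreover have "mem (t\<lparr>pc := l\<rparr>) j = mem s j" if "20 \<le> j" for j
        using same_mem[OF t, of j] that by auto
      ultimately show "Q (t\<lparr>pc := l\<rparr>)" using z 9 10 t by (intro Q) (auto simp: same_def)
    }
  qed
  have loop: "wp (for_loop 5 (basic (check_vertex m))) (1 + n * (8 * m + 14 + 4))
      (wp (unless 9 (basic (map (\<lambda>j. Print (20 + j)) [0..<m] @ [Const 10 1]))) (Suc (m + 1)) Q) s3"
  proof (rule wp_for_loop[where I = I and n = n])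
    show "mem s3 1 = n" using env3 by (simp add: env_def)
    show "I 0 s3" using 13 m3 by (simp add: I_def)
    show "I v s'" if I: "I v s" and same: "same {0, 5} s s'" for v s s'
      using I same_trans[OF _ same, of ?W _ ?W] same_mem[OF same] by (auto simp: I_def)
    show "wp (basic (check_vertex m)) (8 * m + 14)
        (\<lambda>s'. I (Suc v) s' \<and> mem s' 5 = v \<and> mem s' 1 = n) t"
      if v: "v < n" "I v t" "mem t 5 = v" "mem t 1 = n" for v t
    proof -
      note c = check_vertex[OF I_env[OF v(2)] xs(2) v(3,1)]
      have "same ?W s (fold exec_instr (check_vertex m) t)"
        using v(2) by (intro same_trans[OF _ c(1), of ?W s ?W]) (auto simp: I_def)
      moreover have "mem (fold exec_instr (check_vertex m) t) j = mem t j" if "j \<in> {1, 5, 6}" for j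
        using v(2) that by (intro same_mem[OF c(1)]) (auto simp: I_def)
      ultimately have "I (Suc v) (fold exec_instr (check_vertex m) t) \<and>
          mem (fold exec_instr (check_vertex m) t) 5 = v \<and>
          mem (fold exec_instr (check_vertex m) t) 1 = n"
        using v c(2,3) by (simp add: I_def)
      then show ?thesis unfolding length_check_vertex[of m, symmetric]
        by (intro wp_basic no_jump_check)
    qed
  qed (use env(2) last in auto)
  have len: "length ?is = 3 * m + 3"
    by (simp add: add_entries_def length_concat comp_def sum_list_triv)
  show ?thesis unfolding check_tuple_def check_time_def len[symmetric]
    by (intro wp_basic_seq wp_seq) (use loop no_jump_check(1) in \<open>auto simp: s3_def\<close>)
qed


section \<open>Enumerating tuples\<close>

text \<open>The loop counters are themselves the tuple entries, so no tuple ever has to be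
  copied.\<close>

fun nest :: "nat \<Rightarrow> code \<Rightarrow> code" where
  "nest 0 c = c"
| "nest (Suc d) c = for_loop (20 + d) (nest d c)"

fun nest_time :: "nat \<Rightarrow> nat \<Rightarrow> nat \<Rightarrow> nat" where
  "nest_time 0 T n = T"
| "nest_time (Suc d) T n = 1 + n * (nest_time d T n + 4)"

text \<open>\<open>Q\<close> is the set of tuples tested so far, all tuples of smaller length among them.\<close>

definition progress :: "nat \<Rightarrow> nat \<Rightarrow> nat list \<Rightarrow> nat list set \<Rightarrow> ram_state \<Rightarrow> bool" where
  "progress n p L Q s \<longleftrightarrow>
     (if mem s 10 = 0 then out s = [] \<and> (\<forall>xs\<in>Q. \<not> good n p L xs)
      else good n p L (out s) \<and> (\<forall>xs. length xs < length (out s) \<longrightarrow> \<not> good n p L xs))"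

lemma progress_subset: "progress n p L Q s \<Longrightarrow> Q' \<subseteq> Q \<Longrightarrow> progress n p L Q' s"
  by (auto simp: progress_def split: if_splits)

lemma progress_same: "progress n p L Q s \<Longrightarrow> same W s s' \<Longrightarrow> 10 \<notin> W \<Longrightarrow> progress n p L Q s'"
  by (auto simp: progress_def same_def)

text \<open>Induction on the number \<open>d\<close> of loops still to be entered, for arbitrary
  entries \<open>ws\<close> already fixed by the outer loops. That all shorter tuples lie in
  \<open>Q\<close> makes the first hit one of minimal length.\<close>

lemma wp_nest:
  assumes "m \<le> K" "0 < n" "p < n"
    and "env K n p L s" "progress n p L Q s" "{xs. length xs < m} \<subseteq> Q"
    and "d + length ws = m" "set ws \<subseteq> {..<n}" "\<And>i. i < length ws \<Longrightarrow> mem s (20 + d + i) = ws ! i"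
    and "\<And>s'. env K n p L s' \<Longrightarrow> (\<And>i. i < length ws \<Longrightarrow> mem s' (20 + d + i) = ws ! i) \<Longrightarrow>
      progress n p L (Q \<union> {us @ ws |us. length us = d \<and> set us \<subseteq> {..<n}}) s' \<Longrightarrow> R s'"
  shows "wp (nest d (check_tuple K m)) (nest_time d (check_time m n) n) R s"
  using assms(4-)
proof (induction d arbitrary: s ws Q R)
  case 0
  have ws: "tuple m s = ws" using 0 by (auto simp: tuple_def intro: nth_equalityI)
  have "wp (check_tuple K m) (check_time m n) R s"
  proof (rule wp_check_tuple[OF 0(1) assms(2,3) ws 0(5)])
    fix s'
    assume s': "env K n p L s'" "\<And>j. 20 \<le> j \<Longrightarrow> mem s' j = mem s j"
      "if mem s 10 = 0 \<and> good n p L ws then mem s' 10 = 1 \<and> out s' = out s @ ws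
       else mem s' 10 = mem s 10 \<and> out s' = out s"
    have "progress n p L (Q \<union> {ws}) s'"
    proof (cases "mem s 10 = 0 \<and> good n p L ws")
      case True
      then have "out s' = ws" "mem s' 10 = 1" using s'(3) 0(2) by (auto simp: progress_def)
      \<comment> \<open>The flag was still 0, so no tuple in \<open>Q\<close> is good, in particular
        none shorter than \<open>ws\<close>.\<close>
      then show ?thesis using True 0(2,3,4) by (auto simp: progress_def)
    next
      case False
      then show ?thesis using s'(3) 0(2) by (auto simp: progress_def split: if_splits)
    qed
    then show "R s'" using s'(1,2) 0(6) by (intro 0(7)) auto
  qed
  then show ?case by simp
next
  case (Suc d)
  \<comment> \<open>\<open>A v\<close> holds the tuples tested once the counter of this loop, the
    entry just before \<open>ws\<close>, has passed all values below \<open>v\<close>.\<close>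
  define A where "A v = Q \<union> {us @ x # ws |us x. length us = d \<and> set us \<subseteq> {..<n} \<and> x < v}" for v
  define I where "I v t \<longleftrightarrow> env K n p L t \<and> (\<forall>i<length ws. mem t (20 + Suc d + i) = ws ! i) \<and>
    progress n p L (A v) t" for v t
  show ?case unfolding nest.simps nest_time.simps
  proof (rule wp_for_loop[where I = I])
    show "mem s 1 = n" using Suc.prems by (simp add: env_def)
    show "I 0 s" using Suc.prems by (simp add: I_def A_def)
    show "I v s'" if "I v s" "same {0, 20 + d} s s'" for v s s'
    proof -
      have "env K n p L s'"
        by (rule env_same[OF _ that(2)]) (use that(1) Suc.prems(4) assms(1) in \<open>auto simp: I_def\<close>)
      moreover have "progress n p L (A v) s'"
        by (rule progress_same[OF _ that(2)]) (use that(1) in \<open>auto simp: I_def\<close>)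
      moreover have "mem s' (20 + Suc d + i) = mem s (20 + Suc d + i)" for i
        by (rule same_mem[OF that(2)]) auto
      ultimately show ?thesis using that(1) by (simp add: I_def)
    qed
    show "wp (nest d (check_tuple K m)) (nest_time d (check_time m n) n)
        (\<lambda>s'. I (Suc v) s' \<and> mem s' (20 + d) = v \<and> mem s' 1 = n) t"
      if v: "v < n" "I v t" "mem t (20 + d) = v" "mem t 1 = n" for v t
    proof (rule Suc.IH[where ws = "v # ws" and Q = "A v"])
      show "env K n p L t" "progress n p L (A v) t" using v(2) by (auto simp: I_def)
      show "{xs. length xs < m} \<subseteq> A v" using Suc.prems(3) by (auto simp: A_def)
      show "d + length (v # ws) = m" "set (v # ws) \<subseteq> {..<n}" using Suc.prems v by auto
      show "mem t (20 + d + i) = (v # ws) ! i" if "i < length (v # ws)" for i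
        using that v by (cases i) (auto simp: I_def add.assoc)
      fix s'
      assume s': "env K n p L s'"
        "\<And>i. i < length (v # ws) \<Longrightarrow> mem s' (20 + d + i) = (v # ws) ! i"
        "progress n p L (A v \<union> {us @ v # ws |us. length us = d \<and> set us \<subseteq> {..<n}}) s'"
      have "progress n p L (A (Suc v)) s'"
        by (rule progress_subset[OF s'(3)]) (auto simp: A_def less_Suc_eq)
      moreover have "mem s' (20 + Suc d + i) = ws ! i" if "i < length ws" for i
        using s'(2)[of "Suc i"] that by (simp add: add.assoc)
      moreover have "mem s' (20 + d) = v" using s'(2)[of 0] by simp
      ultimately show "I (Suc v) s' \<and> mem s' (20 + d) = v \<and> mem s' 1 = n"
        using s'(1) by (simp add: I_def env_def)
    qed
    show "R s'" if "I n s'" for s'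
    proof (rule Suc.prems(7))
      show "env K n p L s'" using that by (simp add: I_def)
      show "mem s' (20 + Suc d + i) = ws ! i" if "i < length ws" for i
        using that \<open>I n s'\<close> by (simp add: I_def)
      have "Q \<union> {us @ ws |us. length us = Suc d \<and> set us \<subseteq> {..<n}} \<subseteq> A n"
      proof -
        have *: "us @ ws \<in> A n" if "length us = Suc d" "set us \<subseteq> {..<n}" for us
        proof -
          have "us = butlast us @ [last us]" using that by (cases us rule: rev_cases) auto
          then obtain vs x where "us = vs @ [x]" by blast
          then show ?thesis using that by (auto simp: A_def)
        qed
        have "Q \<subseteq> A n" by (simp add: A_def)
        with * show ?thesis by blast
      qed
      then show "progress n p L (Q \<union> {us @ ws |us. length us = Suc d \<and> set us \<subseteq> {..<n}}) s'"
        using that progress_subset by (auto simp: I_def)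
    qed
  qed (use assms in auto)
qed

fun search :: "nat \<Rightarrow> nat \<Rightarrow> code" where
  "search K 0 = basic []"
| "search K (Suc m) = search K m ;; nest m (check_tuple K m)"

fun search_time :: "nat \<Rightarrow> nat \<Rightarrow> nat" where
  "search_time 0 n = 0"
| "search_time (Suc m) n = search_time m n + nest_time m (check_time m n) n"

lemma wp_search:
  assumes "M \<le> Suc K" "0 < n" "p < n" "env K n p L s" "mem s 10 = 0" "out s = []"
    and "\<And>s'. env K n p L s' \<Longrightarrow> progress n p L {xs. length xs < M} s' \<Longrightarrow> R s'"
  shows "wp (search K M) (search_time M n) R s"
  using assms(1,7)
proof (induction M arbitrary: R)
  case 0
  then show ?case using assms by (auto intro!: wp_basic_Nil simp: progress_def)
next
  case (Suc M)
  show ?case unfolding search.simps search_time.simps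
  proof (intro wp_seq Suc.IH)
    fix t assume t: "env K n p L t" "progress n p L {xs. length xs < M} t"
    show "wp (nest M (check_tuple K M)) (nest_time M (check_time M n) n) R t"
    proof (rule wp_nest[where ws = "[]", OF _ assms(2,3) t])
      fix s' assume s': "env K n p L s'"
        "progress n p L ({xs. length xs < M} \<union>
           {us @ [] |us. length us = M \<and> set us \<subseteq> {..<n}}) s'"
      \<comment> \<open>Tuples with entries outside the vertex set were not enumerated, but they are
        not good anyway.\<close>
      have "progress n p L {xs. length xs < Suc M} s'"
        using s'(2) by (auto simp: progress_def less_Suc_eq good_def split: if_splits)
      then show "R s'" using Suc.prems s' by blast
    qed (use Suc.prems in auto)
  qed (use Suc.prems in auto)
qed

section \<open>Reading the input into memory\<close>

definition load :: "nat \<Rightarrow> code" where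
  "load K =
     basic [Read 1, Read 2, Const 13 1, Const 4 (20 + K)] ;;
     for_loop 5
       (basic [Sub 11 5 2, Sub 12 2 5, Add 11 11 12] ;;
        unless 11 (basic [Add 3 4 14]) ;;
        for_loop 6 (basic [Read 11, Store 4 11, Add 4 4 13]))"

definition load_time :: "nat \<Rightarrow> nat" where
  "load_time n = 4 + (1 + n * ((3 + (2 + (1 + n * (3 + 4)))) + 4))"

text \<open>The machine cannot multiply, so the address of row \<open>p\<close> is copied from the
  running address in register 4 when the row counter equals \<open>p\<close>, that is, when their
  distance in register 11 is 0.\<close>

lemma wp_load:
  assumes n: "0 < n" "p < n" and L: "length L = n * n"
    and Q: "\<And>s. env K n p L s \<Longrightarrow> mem s 10 = 0 \<Longrightarrow> out s = [] \<Longrightarrow> Q s"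
  shows "wp (load K) (load_time n) Q (init_state (n # p # L))"
proof -
  \<comment> \<open>\<open>c\<close> is the number of matrix entries stored so far.\<close>
  define J where "J c s \<longleftrightarrow> mem s 1 = n \<and> mem s 2 = p \<and> mem s 13 = 1 \<and> mem s 14 = 0 \<and>
    mem s 10 = 0 \<and> out s = [] \<and> mem s 4 = 20 + K + c \<and> (\<forall>i<c. mem s (20 + K + i) = L ! i) \<and>
    inp s = drop c L" for c and s :: ram_state
  have J_same: "J c s'" if "J c s" "same W s s'" "W \<subseteq> {0, 3, 5, 6, 11, 12}" for c s s' W
  proof -
    have "j \<notin> W" if "j \<in> {1, 2, 4, 10, 13, 14} \<or> 20 \<le> j" for j
      using that \<open>W \<subseteq> _\<close> by (auto simp: subset_eq)
    then show ?thesis using that(1,2) by (simp add: J_def same_def)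
  qed
  define I where "I u s \<longleftrightarrow> J (u * n) s \<and> (p < u \<longrightarrow> mem s 3 = 20 + K + p * n)" for u and s :: ram_state
  have inner: "wp (for_loop 6 (basic [Read 11, Store 4 11, Add 4 4 13])) (1 + n * (3 + 4))
      (\<lambda>s'. I (Suc u) s' \<and> mem s' 5 = u \<and> mem s' 1 = n) s"
    if u: "u < n" "J (u * n) s" "mem s 5 = u" "p \<le> u \<longrightarrow> mem s 3 = 20 + K + p * n" for u s
  proof (rule wp_for_loop[where n = n and
        I = "\<lambda>v s. J (u * n + v) s \<and> mem s 5 = u \<and> (p \<le> u \<longrightarrow> mem s 3 = 20 + K + p * n)"])
    show "mem s 1 = n" using u by (simp add: J_def)
    show "J (u * n + v) s' \<and> mem s' 5 = u \<and> (p \<le> u \<longrightarrow> mem s' 3 = 20 + K + p * n)"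
      if I: "J (u * n + v) s \<and> mem s 5 = u \<and> (p \<le> u \<longrightarrow> mem s 3 = 20 + K + p * n)"
      and same: "same {0, 6} s s'" for v s s'
      using I J_same[OF _ same, of "u * n + v"] same_mem[OF same] by auto
    show "wp (basic [Read 11, Store 4 11, Add 4 4 13]) 3
       (\<lambda>s'. (J (u * n + Suc v) s' \<and> mem s' 5 = u \<and> (p \<le> u \<longrightarrow> mem s' 3 = 20 + K + p * n)) \<and>
          mem s' 6 = v \<and> mem s' 1 = n) t"
      if v: "v < n" "mem t 6 = v" "mem t 1 = n"
        and I: "J (u * n + v) t \<and> mem t 5 = u \<and> (p \<le> u \<longrightarrow> mem t 3 = 20 + K + p * n)" for v t
    proof -
      have "u * n + v < length L" using u v L row_address by simp
      then have inp: "inp t = L ! (u * n + v) # drop (Suc (u * n + v)) L"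
        using I by (simp add: J_def Cons_nth_drop_Suc)
      define t' where "t' = fold exec_instr [Read 11, Store 4 11, Add 4 4 13] t"
      let ?c = "u * n + v"
      have "mem t 4 = 20 + K + ?c" "mem t 13 = 1" using I by (simp_all add: J_def)
      then have t': "mem t' = (mem t)(11 := L ! ?c, 20 + K + ?c := L ! ?c, 4 := 20 + K + Suc ?c)"
        "inp t' = drop (Suc ?c) L" "out t' = out t"
        using inp by (simp_all add: t'_def fun_upd_twist)
      have "J (Suc ?c) t'"
        using I unfolding J_def t' by (simp add: less_Suc_eq)
      then have "(J (u * n + Suc v) t' \<and> mem t' 5 = u \<and> (p \<le> u \<longrightarrow> mem t' 3 = 20 + K + p * n)) \<and>
          mem t' 6 = v \<and> mem t' 1 = n"
        using I v by (simp add: t')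
      then have "wp (basic [Read 11, Store 4 11, Add 4 4 13]) (length [Read 11, Store 4 11, Add 4 4 13])
       (\<lambda>s'. (J (u * n + Suc v) s' \<and> mem s' 5 = u \<and> (p \<le> u \<longrightarrow> mem s' 3 = 20 + K + p * n)) \<and>
          mem s' 6 = v \<and> mem s' 1 = n) t"
        unfolding t'_def by (intro wp_basic) (simp, assumption)
      then show ?thesis by (simp add: eval_nat_numeral)
    qed
    show "I (Suc u) s' \<and> mem s' 5 = u \<and> mem s' 1 = n"
      if "J (u * n + n) s' \<and> mem s' 5 = u \<and> (p \<le> u \<longrightarrow> mem s' 3 = 20 + K + p * n)" for s'
      using that by (auto simp: I_def J_def add.commute)
  qed (use u n in auto)
  have pre: "wp (unless 11 (basic [Add 3 4 14])) 2
       (wp (for_loop 6 (basic [Read 11, Store 4 11, Add 4 4 13])) (1 + n * (3 + 4))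
          (\<lambda>s'. I (Suc u) s' \<and> mem s' 5 = u \<and> mem s' 1 = n)) s"
    if u: "u < n" "J (u * n) s" "mem s 5 = u" "p < u \<longrightarrow> mem s 3 = 20 + K + p * n"
      "mem s 11 = (u - p) + (p - u)" for u s
  proof -
    have "wp (unless 11 (basic [Add 3 4 14])) (Suc (length [Add 3 4 14]))
       (wp (for_loop 6 (basic [Read 11, Store 4 11, Add 4 4 13])) (1 + n * (3 + 4))
          (\<lambda>s'. I (Suc u) s' \<and> mem s' 5 = u \<and> mem s' 1 = n)) s"
    proof (intro wp_unless wp_basic inner)
      assume "mem s 11 = 0"
      then have "u = p" using u by simp
      let ?s = "fold exec_instr [Add 3 4 14] (s\<lparr>pc := Suc (pc s)\<rparr>)"
      have same: "same {3} s ?s" by (simp add: same_def)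
      show "J (u * n) ?s" by (rule J_same[OF u(2) same]) auto
      show "mem ?s 5 = u" using u by simp
      show "p \<le> u \<longrightarrow> mem ?s 3 = 20 + K + p * n" using u \<open>u = p\<close> by (simp add: J_def)
    next
      fix l assume "0 < mem s 11"
      then have "u \<noteq> p" using u by auto
      then show "p \<le> u \<longrightarrow> mem (s\<lparr>pc := l\<rparr>) 3 = 20 + K + p * n" using u by simp
      show "J (u * n) (s\<lparr>pc := l\<rparr>)" by (rule J_same[OF u(2), of "{}"]) (auto simp: same_def)
    qed (use u in auto)
    then show ?thesis by (simp add: eval_nat_numeral)
  qed
  have "wp (for_loop 5
       (basic [Sub 11 5 2, Sub 12 2 5, Add 11 11 12] ;;
        unless 11 (basic [Add 3 4 14]) ;;
        for_loop 6 (basic [Read 11, Store 4 11, Add 4 4 13])))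
       (1 + n * ((3 + (2 + (1 + n * (3 + 4)))) + 4)) Q s" if s: "I 0 s" for s
  proof (rule wp_for_loop[where n = n and I = I])
    show "mem s 1 = n" using s by (simp add: I_def J_def)
    show "I v s'" if "I v s" "same {0, 5} s s'" for v s s'
      using that J_same[OF _ that(2)] same_mem[OF that(2)] by (auto simp: I_def)
    show "wp (basic [Sub 11 5 2, Sub 12 2 5, Add 11 11 12] ;;
        unless 11 (basic [Add 3 4 14]) ;;
        for_loop 6 (basic [Read 11, Store 4 11, Add 4 4 13])) (3 + (2 + (1 + n * (3 + 4))))
        (\<lambda>s'. I (Suc u) s' \<and> mem s' 5 = u \<and> mem s' 1 = n) t"
      if u: "u < n" "I u t" "mem t 5 = u" for u t
    proof -
      let ?is = "[Sub 11 5 2, Sub 12 2 5, Add 11 11 12]"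
      have same: "same {11, 12} t (fold exec_instr ?is t)" by (simp add: same_def)
      have "J (u * n) (fold exec_instr ?is t)" using J_same[OF _ same] u by (auto simp: I_def)
      then have "wp (unless 11 (basic [Add 3 4 14]) ;;
        for_loop 6 (basic [Read 11, Store 4 11, Add 4 4 13])) (2 + (1 + n * (3 + 4)))
        (\<lambda>s'. I (Suc u) s' \<and> mem s' 5 = u \<and> mem s' 1 = n) (fold exec_instr ?is t)"
        using u by (intro wp_seq pre) (auto simp: I_def J_def)
      then have "wp (basic ?is ;; unless 11 (basic [Add 3 4 14]) ;;
        for_loop 6 (basic [Read 11, Store 4 11, Add 4 4 13]))
        (length ?is + (2 + (1 + n * (3 + 4))))
        (\<lambda>s'. I (Suc u) s' \<and> mem s' 5 = u \<and> mem s' 1 = n) t"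
        by (intro wp_basic_seq) auto
      then show ?thesis by (simp add: eval_nat_numeral)
    qed
    show "Q s'" if "I n s'" for s'
      using that n by (intro Q) (auto simp: I_def J_def env_def)
  qed (use n s in auto)
  moreover have "I 0 (fold exec_instr [Read 1, Read 2, Const 13 1, Const 4 (20 + K)]
      (init_state (n # p # L)))"
    by (simp add: I_def J_def init_state_def)
  ultimately have "wp (load K) (length [Read 1, Read 2, Const 13 1, Const 4 (20 + K)] +
      (1 + n * ((3 + (2 + (1 + n * (3 + 4)))) + 4))) Q (init_state (n # p # L))"
    unfolding load_def by (intro wp_basic_seq) auto
  then show ?thesis by (simp add: load_time_def eval_nat_numeral)
qed

section \<open>The program for degree 0\<close>

definition print_others :: code where
  "print_others = basic [Read 1, Read 2] ;;
     for_loop 5 (basic [Sub 11 5 2, Sub 12 2 5, Add 11 11 12, Const 12 1, Sub 11 12 11] ;;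
       unless 11 (basic [Print 5]))"

text \<open>Here register 11 is the negated distance test, 1 exactly at \<open>p\<close>, so that
  only \<open>p\<close> is skipped. The matrix itself is never read.\<close>

lemma wp_print_others:
  assumes "0 < n" "\<And>s. out s = filter (\<lambda>v. v \<noteq> p) [0..<n] \<Longrightarrow> Q s"
  shows "wp print_others (2 + (1 + n * ((5 + 2) + 4))) Q (init_state (n # p # L))"
proof -
  let ?js = "[Sub 11 5 2, Sub 12 2 5, Add 11 11 12, Const 12 1, Sub 11 12 11]"
  define I where "I v s \<longleftrightarrow> mem s 2 = p \<and> out s = filter (\<lambda>v. v \<noteq> p) [0..<v]" for v and s :: ram_state
  have "wp (for_loop 5 (basic ?js ;; unless 11 (basic [Print 5]))) (1 + n * ((5 + 2) + 4)) Q s"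
    if s: "I 0 s" "mem s 1 = n" for s
  proof (rule wp_for_loop[where n = n and I = I])
    show "I v s'" if "I v s" "same {0, 5} s s'" for v s s'
      using that same_mem[OF that(2)] by (auto simp: I_def same_def)
    show "wp (basic ?js ;; unless 11 (basic [Print 5])) (5 + 2)
        (\<lambda>s'. I (Suc v) s' \<and> mem s' 5 = v \<and> mem s' 1 = n) t"
      if v: "v < n" "I v t" "mem t 5 = v" "mem t 1 = n" for v t
    proof -
      have "wp (basic ?js ;; unless 11 (basic [Print 5])) (length ?js + Suc (length [Print 5]))
        (\<lambda>s'. I (Suc v) s' \<and> mem s' 5 = v \<and> mem s' 1 = n) t"
        by (intro wp_basic_seq wp_unless wp_basic) (use v in \<open>auto simp: I_def split: if_splits\<close>)
      then show ?thesis by (simp add: eval_nat_numeral)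
    qed
  qed (use s assms in \<open>auto simp: I_def\<close>)
  then have "wp print_others (length [Read 1, Read 2] + (1 + n * ((5 + 2) + 4))) Q
      (init_state (n # p # L))"
    unfolding print_others_def by (intro wp_basic_seq) (auto simp: init_state_def I_def)
  then show ?thesis by simp
qed

section \<open>Polynomial running times\<close>

definition is_poly :: "(nat \<Rightarrow> nat) \<Rightarrow> bool" where
  "is_poly f \<longleftrightarrow> (\<exists>q. \<forall>n. poly q n = f n)"

lemma is_poly_const: "is_poly (\<lambda>_. c)"
  unfolding is_poly_def by (rule exI[of _ "[:c:]"]) simp

lemma is_poly_ident: "is_poly (\<lambda>n. n)"
  unfolding is_poly_def by (rule exI[of _ "[:0, 1:]"]) simp

lemma is_poly_add: "is_poly f \<Longrightarrow> is_poly g \<Longrightarrow> is_poly (\<lambda>n. f n + g n)"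
  unfolding is_poly_def by (metis poly_add)

lemma is_poly_mult: "is_poly f \<Longrightarrow> is_poly g \<Longrightarrow> is_poly (\<lambda>n. f n * g n)"
  unfolding is_poly_def by (metis poly_mult)

lemmas is_poly_intros = is_poly_const is_poly_ident is_poly_add is_poly_mult

lemma is_poly_nest_time: "is_poly T \<Longrightarrow> is_poly (\<lambda>n. nest_time d (T n) n)"
proof (induction d)
  case (Suc d)
  then show ?case unfolding nest_time.simps by (intro is_poly_intros)
qed simp

text \<open>The tuple length \<open>m\<close> is a constant and only \<open>n\<close> varies, so the
  recursion combines a fixed number of polynomials by sums and products.\<close>

lemma is_poly_search_time: "is_poly (search_time m)"
proof (induction m)
  case (Suc m)
  have "is_poly (\<lambda>n. check_time m n)"
    unfolding check_time_def Suc_eq_plus1 by (intro is_poly_intros)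
  then show ?case unfolding search_time.simps
    by (intro is_poly_add is_poly_nest_time Suc.IH)
qed (simp add: is_poly_const)


section \<open>Regular graphs\<close>

lemma count_list_le_1_iff: "(\<forall>x. count_list xs x \<le> 1) \<longleftrightarrow> distinct xs"
proof (induction xs)
  case (Cons a xs)
  have "(\<forall>x. count_list (a # xs) x \<le> 1) \<longleftrightarrow> count_list xs a = 0 \<and> (\<forall>x. count_list xs x \<le> 1)"
    by (simp add: all_conj_distrib le_Suc_eq) (metis le0 le_Suc_eq)
  then show ?case using Cons by (simp add: count_list_0_iff)
qed simp

lemma sum_list_of_bool_distinct:
  assumes "distinct xs"
  shows "(\<Sum>x\<leftarrow>xs. of_bool (P x) :: nat) = card {x \<in> set xs. P x}"
proof -
  have "(\<Sum>x\<leftarrow>xs. of_bool (P x) :: nat) = length (filter P xs)"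
    by (induction xs) auto
  also have "\<dots> = card {x \<in> set xs. P x}"
    using assms distinct_card[of "filter P xs"] by simp
  finally show ?thesis .
qed

lemma concat_rows:
  assumes "u < m" "v < n"
  shows "concat (map (\<lambda>u. map (f u) [0..<n]) [0..<m]) ! (u * n + v) = f u v"
  using assms(1)
proof (induction m)
  case (Suc m)
  have len: "length (concat (map (\<lambda>u. map (f u) [0..<n]) [0..<m])) = m * n"
    by (simp add: length_concat comp_def sum_list_triv)
  show ?case
  proof (cases "u = m")
    case True
    then show ?thesis using len assms(2) by (simp add: nth_append)
  next
    case False
    then have "u < m" using Suc.prems by simp
    then have "Suc u * n \<le> m * n" by (intro mult_right_mono) auto
    then have "u * n + v < m * n" using assms(2) by simp
    then show ?thesis using Suc.IH \<open>u < m\<close> len by (simp add: nth_append)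
  qed
qed simp

section \<open>Neighbourhoods and feasible deletion sets\<close>

definition neighbours :: "'a pair_pre_digraph \<Rightarrow> 'a \<Rightarrow> 'a set" where
  "neighbours G v = {u. (v, u) \<in> parcs G}"

lemma out_degree_induce:
  assumes "v \<in> W"
  shows "out_degree (induce_subgraph (with_proj G) W) v = card (neighbours G v \<inter> W)"
proof -
  have "out_arcs (induce_subgraph (with_proj G) W) v = Pair v ` (neighbours G v \<inter> W)"
    using assms by (auto simp: neighbours_def)
  then show ?thesis by (simp add: out_degree_def card_image inj_on_def)
qed

lemma out_degree_neighbours: "out_degree (with_proj G) v = card (neighbours G v)"
proof -
  have "out_arcs (with_proj G) v = Pair v ` neighbours G v"
    by (auto simp: neighbours_def)
  then show ?thesis by (simp add: out_degree_def card_image inj_on_def)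
qed

context pair_graph
begin

lemma finite_neighbours: "finite (neighbours G v)"
  and neighbours_subset: "neighbours G v \<subseteq> pverts G"
  and neighbours_sym: "u \<in> neighbours G v \<longleftrightarrow> v \<in> neighbours G u"
  and not_self_neighbour: "v \<notin> neighbours G v"
proof -
  show sub: "neighbours G v \<subseteq> pverts G" by (auto simp: neighbours_def dest: in_arcsD2)
  then show "finite (neighbours G v)" using pair_finite_verts finite_subset by blast
  show "u \<in> neighbours G v \<longleftrightarrow> v \<in> neighbours G u"
    using pair_sym_arcs by (auto simp: neighbours_def symmetric_def dest: symD)
  show "v \<notin> neighbours G v" using pair_no_loops by (fastforce simp: neighbours_def)
qed

text \<open>Neighbours are vertices, so the degree of a remaining \<open>v\<close> drops to the
  number of its neighbours outside \<open>S\<close>; a remaining vertex of degree at most that of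
  \<open>p\<close> would be a second minimum.\<close>

lemma mdd_feasible_iff:
  assumes p: "p \<in> pverts G"
  shows "mdd_feasible G p S \<longleftrightarrow> S \<subseteq> pverts G - {p} \<and>
    (\<forall>v\<in>pverts G - S - {p}. card (neighbours G p - S) < card (neighbours G v - S))"
proof -
  let ?W = "pverts G - S"
  let ?H = "induce_subgraph (with_proj G) ?W"
  have deg: "out_degree ?H v = card (neighbours G v - S)" if "v \<in> ?W" for v
  proof -
    have "neighbours G v \<inter> ?W = neighbours G v - S" using neighbours_subset by blast
    then show ?thesis using out_degree_induce[OF that, of G] by simp
  qed
  have "min_degree_verts ?H = {p} \<longleftrightarrow> (\<forall>v\<in>?W - {p}. out_degree ?H p < out_degree ?H v)"
    if "S \<subseteq> pverts G - {p}"
  proof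
    have pW: "p \<in> ?W" using p that by auto
    assume min: "min_degree_verts ?H = {p}"
    show "\<forall>v\<in>?W - {p}. out_degree ?H p < out_degree ?H v"
    proof (rule ccontr)
      assume "\<not> ?thesis"
      then obtain v where v: "v \<in> ?W" "v \<noteq> p" "out_degree ?H v \<le> out_degree ?H p"
        by (auto simp: not_less)
      have "p \<in> min_degree_verts ?H" using min by simp
      then have "\<forall>u\<in>?W. \<not> out_degree ?H u < out_degree ?H p"
        by (auto simp: min_degree_verts_def is_arg_min_def)
      then have "v \<in> min_degree_verts ?H"
        using v by (auto simp: min_degree_verts_def is_arg_min_def not_less intro: order.trans)
      then show False using min v by simp
    qed
  next
    have pW: "p \<in> ?W" using p that by auto
    assume lt: "\<forall>v\<in>?W - {p}. out_degree ?H p < out_degree ?H v"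
    then have "\<not> out_degree ?H v < out_degree ?H p" if "v \<in> ?W" for v
      using that by (cases "v = p") (auto dest: less_asym)
    then show "min_degree_verts ?H = {p}"
      using lt pW by (auto simp: min_degree_verts_def is_arg_min_def)
  qed
  then show ?thesis using deg p by (auto simp: mdd_feasible_def subset_Diff_insert)
qed

lemma mdd_feasible_card_bound:
  assumes p: "p \<in> pverts G" and reg: "k_regular k G" and k: "0 < k"
  shows "\<exists>S. mdd_feasible G p S \<and> card S \<le> 2 * k"
proof -
  have card: "card (neighbours G v) = k" if "v \<in> pverts G" for v
    using reg that by (simp add: k_regular_def out_degree_neighbours)
  define I where "I = {v \<in> pverts G - {p}. neighbours G v \<subseteq> neighbours G p}"
  define S where "S = neighbours G p \<union> I"
  \<comment> \<open>Positive degree provides the neighbour \<open>q\<close> whose neighbourhood will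
    bound \<open>I\<close>.\<close>
  obtain q where q: "q \<in> neighbours G p" using card[OF p] k by fastforce
  have "I \<subseteq> neighbours G q"
  proof
    fix v assume v: "v \<in> I"
    \<comment> \<open>Inclusion becomes equality because both sets have \<open>k\<close>
      elements.\<close>
    then have "neighbours G v = neighbours G p"
      using card p by (intro card_subset_eq finite_neighbours) (auto simp: I_def)
    then show "v \<in> neighbours G q" using q neighbours_sym[of q v] by simp
  qed
  moreover have "q \<in> pverts G" using q neighbours_subset by auto
  ultimately have "card I \<le> k" using card_mono[OF finite_neighbours] card by metis
  then have "card S \<le> 2 * k" using card_Un_le[of "neighbours G p" I] card[OF p] by (simp add: S_def)
  moreover have "mdd_feasible G p S" unfolding mdd_feasible_iff[OF p]
  proof (intro conjI ballI)
    show "S \<subseteq> pverts G - {p}"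
      using neighbours_subset not_self_neighbour by (auto simp: S_def I_def)
    fix v assume v: "v \<in> pverts G - S - {p}"
    then obtain w where w: "w \<in> neighbours G v" "w \<notin> neighbours G p" by (auto simp: S_def I_def)
    \<comment> \<open>Otherwise \<open>v\<close>, being a neighbour of \<open>w\<close>, would be a
      neighbour of \<open>p\<close> and hence deleted.\<close>
    have "w \<notin> I" using w(1) v neighbours_sym[of w v] by (auto simp: I_def S_def)
    then have "w \<in> neighbours G v - S" using w by (simp add: S_def)
    moreover have "neighbours G p - S = {}" by (auto simp: S_def)
    ultimately show "card (neighbours G p - S) < card (neighbours G v - S)"
      by (metis card.empty card_gt_0_iff empty_iff finite_Diff finite_neighbours)
  qed
  ultimately show ?thesis by blast
qed

end

lemma good_iff_feasible:
  assumes "pair_graph G" and V: "pverts G = {0..<n}" and p: "p \<in> pverts G" and reg: "k_regular k G"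
    and L: "\<And>u v. u < n \<Longrightarrow> v < n \<Longrightarrow> L ! (u * n + v) = of_bool (v \<in> neighbours G u)"
  shows "good n p L xs \<longleftrightarrow> distinct xs \<and> mdd_feasible G p (set xs)"
proof -
  interpret pair_graph G by fact
  have row: "row_sum n L xs u = card (neighbours G u \<inter> set xs)"
    if "distinct xs" "set xs \<subseteq> {..<n}" "u < n" for u
  proof -
    have "row_sum n L xs u = (\<Sum>x\<leftarrow>xs. of_bool (x \<in> neighbours G u))"
      unfolding row_sum_def using that L by (intro arg_cong[where f = sum_list] map_cong) auto
    then show ?thesis
      using sum_list_of_bool_distinct[OF that(1)] by (simp add: Int_def conj_commute)
  qed
  \<comment> \<open>Subtraction from the common degree \<open>k\<close> reverses strict comparisons;
    the bound by \<open>k\<close> rules out truncation.\<close>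
  have card: "card (neighbours G u - S) = k - card (neighbours G u \<inter> S)"
    "card (neighbours G u \<inter> S) \<le> k" if "u < n" for u S
  proof -
    have "card (neighbours G u) = k"
      using reg that V by (simp add: k_regular_def out_degree_neighbours)
    then show "card (neighbours G u - S) = k - card (neighbours G u \<inter> S)"
      "card (neighbours G u \<inter> S) \<le> k"
      using finite_neighbours by (auto simp: card_Diff_subset_Int intro: card_mono)
  qed
  have pn: "p < n" using p V by simp
  have mult: "(\<forall>v<n. multiplicity_with p xs v \<le> 1) \<longleftrightarrow> distinct xs \<and> p \<notin> set xs" if "set xs \<subseteq> {..<n}"
  proof -
    \<comment> \<open>The machine inspects only \<open>v < n\<close>; other numbers do not occur in
      the tuple, so this suffices for distinctness.\<close>
    have "count_list xs v = 0" if "\<not> v < n" for v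
      using that \<open>set xs \<subseteq> _\<close> by (auto simp: count_list_0_iff)
    then have "distinct xs \<longleftrightarrow> (\<forall>v<n. count_list xs v \<le> 1)"
      unfolding count_list_le_1_iff[symmetric] by (metis le0)
    moreover have "multiplicity_with p xs v \<le> 1 \<longleftrightarrow> count_list xs v \<le> 1 \<and> (v = p \<longrightarrow> count_list xs v = 0)" for v
      by (auto simp: multiplicity_with_def)
    ultimately show ?thesis using pn by (auto simp: count_list_0_iff)
  qed
  have mult_pos: "multiplicity_with p xs v = 0 \<longleftrightarrow> v \<noteq> p \<and> v \<notin> set xs" for v
    by (auto simp: multiplicity_with_def count_list_0_iff)
  have viol: "violation n p L xs v = 0 \<longleftrightarrow> multiplicity_with p xs v \<le> 1 \<and>
      (multiplicity_with p xs v = 0 \<longrightarrow> row_sum n L xs v < row_sum n L xs p)" for v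
    by (auto simp: violation_def)
  have "good n p L xs \<longleftrightarrow> set xs \<subseteq> {..<n} \<and> distinct xs \<and> p \<notin> set xs \<and>
      (\<forall>v<n. v \<noteq> p \<and> v \<notin> set xs \<longrightarrow> row_sum n L xs v < row_sum n L xs p)"
    unfolding good_def viol mult_pos using mult by blast
  also have "\<dots> \<longleftrightarrow> set xs \<subseteq> {..<n} \<and> distinct xs \<and> p \<notin> set xs \<and>
      (\<forall>v<n. v \<noteq> p \<and> v \<notin> set xs \<longrightarrow>
        card (neighbours G p - set xs) < card (neighbours G v - set xs))"
  proof -
    have "row_sum n L xs v < row_sum n L xs p \<longleftrightarrow>
        card (neighbours G p - set xs) < card (neighbours G v - set xs)"
      if "distinct xs" "set xs \<subseteq> {..<n}" "v < n" for v
      using row[OF that] row[OF that(1,2) pn] card[OF that(3), of "set xs"] card[OF pn, of "set xs"]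
      by linarith
    then show ?thesis by blast
  qed
  also have "\<dots> \<longleftrightarrow> distinct xs \<and> mdd_feasible G p (set xs)"
    unfolding mdd_feasible_iff[OF p] V by auto
  finally show ?thesis .
qed

section \<open>Assembling the algorithms\<close>

lemma is_poly_load_time: "is_poly load_time"
proof -
  have "is_poly (\<lambda>n. load_time n)" unfolding load_time_def by (intro is_poly_intros)
  then show ?thesis .
qed

text \<open>The program depends on \<open>k\<close> alone. Searching up to length
  \<open>2 * k\<close> must succeed by \<open>mdd_feasible_card_bound\<close>, and a shortest good
  tuple lists a smallest feasible set.\<close>

lemma positive_degree_solvable:
  assumes k: "0 < k"
  shows "poly_time_solvable (mdd_regular_instances k) mdd_encode mdd_min_output mdd_num_verts"
proof -
  let ?K = "2 * k"
  let ?P = "load ?K ;; search ?K (Suc ?K)"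
  have "is_poly (\<lambda>n. load_time n + search_time (Suc ?K) n)"
    by (intro is_poly_add is_poly_load_time is_poly_search_time)
  then obtain q where q: "\<And>n. poly q n = load_time n + search_time (Suc ?K) n"
    unfolding is_poly_def by blast
  have "\<exists>ys. computes_within (?P 0) (mdd_encode (G, p)) (poly q (mdd_num_verts (G, p))) ys \<and>
      mdd_min_output (G, p) ys"
    if inst: "(G, p) \<in> mdd_regular_instances k" for G p
  proof -
    interpret pair_graph G using inst by (simp add: mdd_regular_instances_def)
    define n where "n = card (pverts G)"
    have V: "pverts G = {0..<n}" and p: "p \<in> pverts G" and reg: "k_regular k G"
      using inst by (auto simp: mdd_regular_instances_def n_def)
    define L :: "nat list" where
      "L = concat (map (\<lambda>u. map (\<lambda>v. of_bool ((u, v) \<in> parcs G)) [0..<n]) [0..<n])"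
    have enc: "mdd_encode (G, p) = n # p # L" by (simp add: mdd_encode_def L_def n_def Let_def)
    have len: "length L = n * n"
      by (simp add: L_def length_concat comp_def sum_list_triv)
    have L: "L ! (u * n + v) = of_bool (v \<in> neighbours G u)" if "u < n" "v < n" for u v
      unfolding L_def
      using concat_rows[OF that, of "\<lambda>u v. of_bool ((u, v) \<in> parcs G)"]
      by (simp add: neighbours_def)
    have pn: "p < n" "0 < n" using p V by auto
    have good: "good n p L xs \<longleftrightarrow> distinct xs \<and> mdd_feasible G p (set xs)" for xs
      using good_iff_feasible[OF pair_graph V p reg] L by blast
    have "wp ?P (load_time n + search_time (Suc ?K) n) (progress n p L {xs. length xs < Suc ?K})
        (init_state (n # p # L))"
      by (intro wp_seq wp_load wp_search) (use pn len in auto)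
    then obtain s where s: "computes_within (?P 0) (n # p # L)
        (load_time n + search_time (Suc ?K) n) (out s)" "progress n p L {xs. length xs < Suc ?K} s"
      using wp_computes by blast
    have list: "\<exists>xs. good n p L xs \<and> length xs = card S" if S: "mdd_feasible G p S" for S
    proof -
      have "finite S"
        using S pair_finite_verts by (auto simp: mdd_feasible_def intro: finite_subset)
      then show ?thesis using S
        by (intro exI[of _ "sorted_list_of_set S"]) (simp add: good)
    qed
    obtain S where "mdd_feasible G p S" "card S \<le> ?K"
      using mdd_feasible_card_bound[OF p reg k] by blast
    then have "\<exists>xs. good n p L xs \<and> length xs < Suc ?K" using list by fastforce
    \<comment> \<open>A good tuple within the searched lengths excludes the case of
      \<open>progress\<close> in which nothing has been printed.\<close>
    then have out: "good n p L (out s)" "\<And>xs. good n p L xs \<Longrightarrow> length (out s) \<le> length xs"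
      using s(2) by (auto simp: progress_def not_less[symmetric] split: if_splits)
    have "card (set (out s)) \<le> card S" if "mdd_feasible G p S" for S
      using list[OF that] out good distinct_card by metis
    then have "mdd_min_output (G, p) (out s)"
      using out(1) good
      by (auto simp: mdd_min_output_def mdd_min_solution_def is_arg_min_def not_less)
    then show ?thesis using s(1) q enc by (auto simp: mdd_num_verts_def n_def)
  qed
  then show ?thesis unfolding poly_time_solvable_def by fast
qed

lemma degree_0_solvable:
  "poly_time_solvable (mdd_regular_instances 0) mdd_encode mdd_min_output mdd_num_verts"
proof -
  have "is_poly (\<lambda>n. 2 + (1 + n * ((5 + 2) + 4)))" by (intro is_poly_intros)
  then obtain q where q: "\<And>n::nat. poly q n = 2 + (1 + n * ((5 + 2) + 4))"
    unfolding is_poly_def by blast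
  have "\<exists>ys. computes_within (print_others 0) (mdd_encode (G, p)) (poly q (mdd_num_verts (G, p))) ys \<and>
      mdd_min_output (G, p) ys"
    if inst: "(G, p) \<in> mdd_regular_instances 0" for G p
  proof -
    interpret pair_graph G using inst by (simp add: mdd_regular_instances_def)
    define n where "n = card (pverts G)"
    have V: "pverts G = {0..<n}" and p: "p \<in> pverts G" and reg: "k_regular 0 G"
      using inst by (auto simp: mdd_regular_instances_def n_def)
    obtain L where enc: "mdd_encode (G, p) = n # p # L" by (simp add: mdd_encode_def n_def Let_def)
    have pn: "0 < n" using p V by auto
    let ?ys = "filter (\<lambda>v. v \<noteq> p) [0..<n]"
    have "wp print_others (2 + (1 + n * ((5 + 2) + 4))) (\<lambda>s. out s = ?ys) (init_state (n # p # L))"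
      by (intro wp_print_others pn)
    from wp_computes[OF this] have comp: "computes_within (print_others 0) (n # p # L) (2 + (1 + n * ((5 + 2) + 4))) ?ys"
      by auto
    have "neighbours G v = {}" if "v \<in> pverts G" for v
      using reg that finite_neighbours by (simp add: k_regular_def out_degree_neighbours)
    \<comment> \<open>All degrees are and remain 0, so no vertex can exceed \<open>p\<close>
      strictly and none but \<open>p\<close> may remain.\<close>
    then have feas: "mdd_feasible G p S \<longleftrightarrow> S = pverts G - {p}" for S
      using p unfolding mdd_feasible_iff[OF p] by auto
    have "set ?ys = pverts G - {p}" by (auto simp: V)
    then have "mdd_min_output (G, p) ?ys"
      by (simp add: mdd_min_output_def mdd_min_solution_def is_arg_min_def feas)
    then show ?thesis using comp q enc by (auto simp: mdd_num_verts_def n_def)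
  qed
  then show ?thesis unfolding poly_time_solvable_def by fast
qed

theorem theorem5:
  fixes k :: nat
  shows "poly_time_solvable (mdd_regular_instances k) mdd_encode mdd_min_output mdd_num_verts"
  using degree_0_solvable positive_degree_solvable by (cases "k = 0") auto

end
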